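(* Let $n\ge 2$ be an integer, let $F:\mathbb{R}^n\to[0,\infty)$ be a strongly convex Finsler norm with polar $F_\circ$, let $\Omega\subset\mathbb{R}^n$ be a bounded domain that contains the origin, and let $R_\Omega:=\sup_{x\in\Omega}F_\circ(x)$. Let $u\in W^{1,n}_0(\Omega)$, $u\not\equiv 0$, and set \[ I_{F,dx}[u]:=\int_\Omega F(\nabla u)^n\,dx-\left(\frac{n-1}{n}\right)^n\int_\Omega\frac{|u|^n}{F_\circ(x)^n}X_1^n\left(\frac{F_\circ(x)}{R_\Omega}\right)dx . \] Then \[ \int_{\Omega}\exp\left(\gamma\left[|u(x)|\,X_2^{2/n}\left(\frac{F_\circ(x)}{R_\Omega}\right)\right]^{\frac{n}{n-1}}\right)dx<+\infty \] for every $\gamma<\left(C_{n,F}^{\,n}\,I_{F,dx}[u]\right)^{-\frac{1}{n-1}}$, where \[ C_{n,F}:=\frac1n\,\omega_n^{-\frac1n}\left[\alpha^{-1}2^{\frac{n-1}{n}}\sigma_F+\tilde\beta\,\frac{n+1}{n}\,n^{\frac2n}\kappa_n^{\frac1n}\right]. \]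
   Context: A strongly convex Finsler norm is a function $F:\mathbb{R}^n\to[0,\infty)$ that is even, positively $1$-homogeneous, of class $C^2(\mathbb{R}^n\setminus\{0\})$, and such that the Hessian $\nabla^2(F^2)(\xi)$ is positive definite for every $\xi\ne0$. Its polar is $F_\circ(x):=\sup_{\xi\neq0}\frac{\xi\cdot x}{F(\xi)}$. Auxiliary functions: $X_1(t):=(1-\log t)^{-1}$ for $t\in(0,1]$, $X_1(0):=0$, and $X_2(t):=X_1(X_1(t))$. Constants: $\omega_n$ is the Lebesgue measure of the Euclidean unit ball of $\mathbb{R}^n$; $\alpha>0$ is a constant such that $\alpha|\xi|\le F(\xi)$ for all $\xi\in\mathbb{R}^n$; $\tilde\beta:=\max_{|x|=1}|\nabla F_\circ(x)|$; $\kappa_n:=\frac2n\left(\frac{n}{n-1}\right)^{n-2}$; and $\sigma_F\ge1$ is a constant depending only on $F$ such that, for every bounded domain $\Omega\subset\mathbb{R}^n$ and every $u\in C^1_c(\Omega)$, setting $R_\Omega:=\sup_{x\in\Omega}F_\circ(x)$ and $v(x):=X_1^{1-1/n}\left(\frac{F_\circ(x)}{R_\Omega}\right)u(x)$, one has \[ \int_\Omega F^n(\nabla v)\,X_1^{1-n}\left(\frac{F_\circ(x)}{R_\Omega}\right)dx\le 2^{n-1}\sigma_F^n\left[\int_\Omega F(\nabla u)^n\,dx-\left(\frac{n-1}{n}\right)^n\int_\Omega\frac{|u|^n}{F_\circ(x)^n}X_1^n\left(\frac{F_\circ(x)}{R_\Omega}\right)dx\right] \] (such a constant exists). *)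

theory Defs
  imports "HOL-Analysis.Analysis"
begin

section \<open>Classical differentiability\<close>

definition grad :: "(real^'n \<Rightarrow> real) \<Rightarrow> real^'n \<Rightarrow> real^'n" where
  "grad f x = (\<chi> i. frechet_derivative f (at x) (axis i 1))"

definition hessian :: "(real^'n \<Rightarrow> real) \<Rightarrow> real^'n \<Rightarrow> real^'n^'n" where
  "hessian f x = jacobian (grad f) (at x)"

text \<open>Only meant for open \<open>S\<close>.\<close>

primrec Ck_on :: "nat \<Rightarrow> (real^'n \<Rightarrow> real) \<Rightarrow> (real^'n) set \<Rightarrow> bool" where
  "Ck_on 0 f S \<longleftrightarrow> continuous_on S f"
| "Ck_on (Suc k) f S \<longleftrightarrow>
     (\<forall>x\<in>S. f differentiable (at x)) \<and> (\<forall>i. Ck_on k (\<lambda>x. grad f x $ i) S)"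

definition compactly_supported_in :: "(real^'n \<Rightarrow> real) \<Rightarrow> (real^'n) set \<Rightarrow> bool" where
  "compactly_supported_in f \<Omega> \<longleftrightarrow>
     compact (closure {x. f x \<noteq> 0}) \<and> closure {x. f x \<noteq> 0} \<subseteq> \<Omega>"

text \<open>The elements of \<open>C\<^sup>1\<^sub>c(\<Omega>)\<close> and of \<open>C\<^sup>\<infinity>\<^sub>c(\<Omega>)\<close> are identified with their extensions by zero.\<close>

definition C1c :: "(real^'n) set \<Rightarrow> (real^'n \<Rightarrow> real) set" where
  "C1c \<Omega> = {f. Ck_on 1 f UNIV \<and> compactly_supported_in f \<Omega>}"

definition Cinfc :: "(real^'n) set \<Rightarrow> (real^'n \<Rightarrow> real) set" where
  "Cinfc \<Omega> = {f. (\<forall>k. Ck_on k f UNIV) \<and> compactly_supported_in f \<Omega>}"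

definition bounded_domain :: "(real^'n) set \<Rightarrow> bool" where
  "bounded_domain \<Omega> \<longleftrightarrow> open \<Omega> \<and> connected \<Omega> \<and> \<Omega> \<noteq> {} \<and> bounded \<Omega>"


section \<open>Sobolev spaces\<close>

text \<open>Functions on \<open>\<Omega>\<close> are represented by total functions whose values outside \<open>\<Omega>\<close> are irrelevant.\<close>

definition locally_integrable_on ::
    "(real^'n) set \<Rightarrow> (real^'n \<Rightarrow> 'b::{banach,second_countable_topology}) \<Rightarrow> bool" where
  "locally_integrable_on \<Omega> f \<longleftrightarrow>
     (\<forall>K. compact K \<and> K \<subseteq> \<Omega> \<longrightarrow> integrable (lebesgue_on K) f)"

definition Lp :: "nat \<Rightarrow> (real^'n) set \<Rightarrow> (real^'n \<Rightarrow> 'b::{banach,second_countable_topology}) set"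
  where
  "Lp p \<Omega> = {f. f \<in> borel_measurable (lebesgue_on \<Omega>) \<and>
                 integrable (lebesgue_on \<Omega>) (\<lambda>x. norm (f x) ^ p)}"

definition has_weak_grad ::
    "(real^'n) set \<Rightarrow> (real^'n \<Rightarrow> real) \<Rightarrow> (real^'n \<Rightarrow> real^'n) \<Rightarrow> bool" where
  "has_weak_grad \<Omega> u g \<longleftrightarrow>
     locally_integrable_on \<Omega> u \<and> locally_integrable_on \<Omega> g \<and>
     (\<forall>\<phi>\<in>Cinfc \<Omega>. (\<integral>x. u x *\<^sub>R grad \<phi> x \<partial>lebesgue_on \<Omega>) = - (\<integral>x. \<phi> x *\<^sub>R g x \<partial>lebesgue_on \<Omega>))"

text \<open>A choice of representative: weak gradients are unique up to null sets.\<close>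

definition weak_grad :: "(real^'n) set \<Rightarrow> (real^'n \<Rightarrow> real) \<Rightarrow> real^'n \<Rightarrow> real^'n" where
  "weak_grad \<Omega> u = (SOME g. has_weak_grad \<Omega> u g)"

definition W1 :: "nat \<Rightarrow> (real^'n) set \<Rightarrow> (real^'n \<Rightarrow> real) set" where
  "W1 p \<Omega> = {u. u \<in> Lp p \<Omega> \<and> (\<exists>g. has_weak_grad \<Omega> u g) \<and> weak_grad \<Omega> u \<in> Lp p \<Omega>}"

text \<open>The closure of \<open>C\<^sup>\<infinity>\<^sub>c(\<Omega>)\<close> in the norm of \<open>W\<^sup>1\<^sup>,\<^sup>p(\<Omega>)\<close>.\<close>

definition W1_0 :: "nat \<Rightarrow> (real^'n) set \<Rightarrow> (real^'n \<Rightarrow> real) set" where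
  "W1_0 p \<Omega> = {u \<in> W1 p \<Omega>. \<exists>\<phi>. (\<forall>k::nat. \<phi> k \<in> Cinfc \<Omega>) \<and>
     (\<lambda>k. (\<integral>x. \<bar>\<phi> k x - u x\<bar> ^ p \<partial>lebesgue_on \<Omega>)
          + (\<integral>x. norm (grad (\<phi> k) x - weak_grad \<Omega> u x) ^ p \<partial>lebesgue_on \<Omega>)) \<longlonglongrightarrow> 0}"


section \<open>Finsler norms and the Hardy functional\<close>

definition strongly_convex_finsler_norm :: "(real^'n \<Rightarrow> real) \<Rightarrow> bool" where
  "strongly_convex_finsler_norm F \<longleftrightarrow>
     (\<forall>\<xi>. F \<xi> \<ge> 0) \<and>
     (\<forall>\<xi>. F (- \<xi>) = F \<xi>) \<and>
     (\<forall>t>0. \<forall>\<xi>. F (t *\<^sub>R \<xi>) = t * F \<xi>) \<and>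
     Ck_on 2 F (- {0}) \<and>
     (\<forall>\<xi>. \<xi> \<noteq> 0 \<longrightarrow> (\<forall>h. h \<noteq> 0 \<longrightarrow> h \<bullet> (hessian (\<lambda>\<zeta>. (F \<zeta>)\<^sup>2) \<xi> *v h) > 0))"

definition polar :: "(real^'n \<Rightarrow> real) \<Rightarrow> real^'n \<Rightarrow> real" where
  "polar F x = (SUP \<xi>\<in>- {0}. (\<xi> \<bullet> x) / F \<xi>)"

definition R_of :: "(real^'n \<Rightarrow> real) \<Rightarrow> (real^'n) set \<Rightarrow> real" where
  "R_of F \<Omega> = (SUP x\<in>\<Omega>. polar F x)"

text \<open>Only used on \<open>[0,1]\<close>.\<close>

definition X1 :: "real \<Rightarrow> real" where
  "X1 t = (if t = 0 then 0 else inverse (1 - ln t))"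

definition X2 :: "real \<Rightarrow> real" where
  "X2 t = X1 (X1 t)"

text \<open>\<open>I_fun F \<Omega> u Du\<close> is the functional \<open>I\<^bsub>F,dx\<^esub>[u]\<close> with \<open>Du\<close> in place of \<open>\<nabla>u\<close>, so that it serves
  both classical and weak gradients. The integrands below are singular only at the origin, where
  the values of \<open>/\<close>, \<open>powr\<close> and \<^const>\<open>grad\<close> do not affect the integrals.\<close>

definition I_fun ::
    "(real^'n \<Rightarrow> real) \<Rightarrow> (real^'n) set \<Rightarrow> (real^'n \<Rightarrow> real) \<Rightarrow> (real^'n \<Rightarrow> real^'n) \<Rightarrow> real" where
  "I_fun F \<Omega> u Du =
     (\<integral>x. F (Du x) ^ CARD('n) \<partial>lebesgue_on \<Omega>)
     - ((real CARD('n) - 1) / real CARD('n)) ^ CARD('n) *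
       (\<integral>x. \<bar>u x\<bar> ^ CARD('n) / polar F x ^ CARD('n) * X1 (polar F x / R_of F \<Omega>) ^ CARD('n)
          \<partial>lebesgue_on \<Omega>)"

text \<open>The property required of \<open>\<sigma>\<^sub>F\<close>. Since Bochner integrals of non-integrable functions are \<open>0\<close>,
  the finiteness contained in the upper bound for the nonnegative left-hand integrand is spelled
  out as integrability.\<close>

definition sigma_constant :: "(real^'n \<Rightarrow> real) \<Rightarrow> real \<Rightarrow> bool" where
  "sigma_constant F \<sigma> \<longleftrightarrow> \<sigma> \<ge> 1 \<and>
     (\<forall>\<Omega> u. bounded_domain \<Omega> \<longrightarrow> u \<in> C1c \<Omega> \<longrightarrow>
        (let n = CARD('n);
             v = (\<lambda>x. X1 (polar F x / R_of F \<Omega>) powr (1 - 1 / real n) * u x);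
             f = (\<lambda>x. F (grad v x) ^ n * X1 (polar F x / R_of F \<Omega>) powr (1 - real n))
         in integrable (lebesgue_on \<Omega>) f \<and>
            (\<integral>x. f x \<partial>lebesgue_on \<Omega>) \<le> 2 ^ (n - 1) * \<sigma> ^ n * I_fun F \<Omega> u (grad u)))"

definition omega :: "'n::finite itself \<Rightarrow> real" where
  "omega _ = measure lebesgue (ball (0 :: real^'n) 1)"

definition kappa :: "nat \<Rightarrow> real" where
  "kappa n = 2 / real n * (real n / (real n - 1)) ^ (n - 2)"

definition beta_tilde :: "(real^'n \<Rightarrow> real) \<Rightarrow> real" where
  "beta_tilde F = (SUP x\<in>sphere 0 1. norm (grad (polar F) x))"

definition C_const :: "(real^'n \<Rightarrow> real) \<Rightarrow> real \<Rightarrow> real \<Rightarrow> real" where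
  "C_const F \<alpha> \<sigma> = (let n = real CARD('n) in
     1 / n * omega TYPE('n) powr (- 1 / n) *
     (inverse \<alpha> * 2 powr ((n - 1) / n) * \<sigma>
      + beta_tilde F * ((n + 1) / n) * n powr (2 / n) * kappa CARD('n) powr (1 / n)))"

end

theory Submission
  imports Defs
begin

text \<open>
  On \<open>\<Omega>\<close> the weight \<open>X\<^sub>2\<close> takes values in \<open>[0, 1]\<close>, so it suffices to show that
  \<open>exp (c \<bar>u\<bar>\<^bsup>n/(n-1)\<^esup>)\<close> is integrable for every \<open>c\<close>. For a single function this is Trudinger's
  inequality without any sharp constant: \<open>u\<close> is a bounded test function plus a remainder whose
  gradient is as small in \<open>L\<^sup>n\<close> as desired, and the smaller the gradient, the faster the
  exponential decay of the level sets.

  The decay comes from averaging \<open>\<bar>\<psi>(x)\<bar> \<le> \<integral> \<bar>\<nabla>\<psi>(x + r z)\<bar> dr\<close> over an annulus of directions \<open>z\<close> and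
  cutting the range of \<open>r\<close> at \<open>\<delta>\<close>. The part \<open>r < \<delta>\<close> has \<open>L\<^sup>1\<close> norm of order \<open>\<delta>\<close>. The part \<open>r \<ge> \<delta>\<close> is
  bounded pointwise through \<open>\<integral> \<bar>\<nabla>\<psi>\<bar>\<^sup>n\<close> and \<open>ln (1/\<delta>)\<close>. A logarithm of order \<open>t\<^bsup>n/(n-1)\<^esup>\<close> is admissible
  at level \<open>t\<close>, and Chebyshev's inequality for the first part gives the claim.
\<close>

section \<open>Averaging along rays over an annulus of directions\<close>

text \<open>A full-dimensional stand-in for the unit sphere: integrals over directions become
  Lebesgue integrals, so Fubini and a linear substitution do the work of polar coordinates. The
  lower bound on the norm makes rays leave a ball in controlled time; the upper bound keeps
  directional derivatives below the norm of the gradient.\<close>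

definition annulus :: "'a::real_normed_vector set" where
  "annulus = {z. 1 / 2 < norm z \<and> norm z < 1}"

lemma annulus_borel [measurable]: "annulus \<in> sets (borel :: 'a::euclidean_space measure)"
proof -
  have "annulus = {z \<in> space borel. 1 / 2 < norm (z::'a) \<and> norm z < 1}"
    by (auto simp: annulus_def)
  also have "\<dots> \<in> sets borel" by measurable
  finally show ?thesis .
qed

lemma emeasure_annulus_finite: "emeasure lborel (annulus :: 'a::euclidean_space set) < \<infinity>"
  by (rule emeasure_bounded_finite) (auto intro!: boundedI[of _ 1] simp: annulus_def)

lemma measure_annulus_pos: "0 < measure lborel (annulus :: 'a::euclidean_space set)"
proof -
  have op: "open (annulus :: 'a set)"
  proof -
    have "open {z::'a. 1 / 2 < norm z \<and> norm z < 1}"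
      by (intro open_Collect_conj open_Collect_less continuous_intros)
    then show ?thesis by (simp add: annulus_def)
  qed
  obtain b :: 'a where "b \<in> Basis" using nonempty_Basis by blast
  then have "(3 / 4) *\<^sub>R b \<in> annulus" by (simp add: annulus_def)
  then have "annulus \<notin> null_sets (lborel :: 'a measure)"
    by (metis op empty_iff null_sets_completionI negligible_iff_null_sets
        open_not_negligible)
  then have "emeasure lborel (annulus :: 'a set) \<noteq> 0"
    by (auto simp: null_sets_def)
  then show ?thesis
    using emeasure_annulus_finite[where 'a='a]
    by (simp add: measure_def enn2real_positive_iff top.not_eq_extremum zero_less_iff_neq_zero)
qed

lemma nn_integral_lborel_shift:
  fixes c :: "'a::euclidean_space"
  assumes [measurable]: "f \<in> borel_measurable borel"
  shows "(\<integral>\<^sup>+x. f (c + x) \<partial>lborel) = (\<integral>\<^sup>+x. f x \<partial>lborel)"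
  by (subst (2) lborel_distr_plus[of c, symmetric]) (simp add: nn_integral_distr)

lemma nn_integral_lborel_scaleR:
  fixes f :: "'a::euclidean_space \<Rightarrow> ennreal"
  assumes [measurable]: "f \<in> borel_measurable borel" and "r > 0"
  shows "(\<integral>\<^sup>+x. f x \<partial>lborel) = ennreal (r ^ DIM('a)) * (\<integral>\<^sup>+x. f (r *\<^sub>R x) \<partial>lborel)"
  using \<open>r > 0\<close> by (subst lborel_affine[of r 0])
    (simp_all add: nn_integral_density nn_integral_distr nn_integral_cmult ennreal_power)

text \<open>The fundamental theorem of calculus along the ray from \<open>x\<close> in direction
  \<open>z\<close>. The length \<open>4 * \<rho>\<close> suffices because
  \<open>norm z > 1 / 2\<close> moves the point by more than \<open>2 * \<rho>\<close>, into the
  region where \<open>\<psi>\<close> vanishes; \<open>norm z < 1\<close> removes the factor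
  \<open>norm z\<close> left by Cauchy-Schwarz.\<close>

lemma abs_le_ray_integral:
  fixes \<psi> :: "'a::euclidean_space \<Rightarrow> real"
  assumes der: "\<And>x. (\<psi> has_derivative (\<lambda>h. g x \<bullet> h)) (at x)"
    and cont: "continuous_on UNIV g"
    and supp: "\<And>x. \<rho> \<le> norm x \<Longrightarrow> \<psi> x = 0"
    and x: "norm x < \<rho>" and z: "z \<in> annulus"
  shows "ennreal \<bar>\<psi> x\<bar> \<le> (\<integral>\<^sup>+r\<in>{0..4 * \<rho>}. ennreal (norm (g (x + r *\<^sub>R z))) \<partial>lborel)"
proof -
  have \<rho>: "\<rho> > 0" using x by (meson norm_ge_zero order.strict_trans1)
  have z': "1 / 2 < norm z" "norm z < 1" using z by (auto simp: annulus_def)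
  have cont_r: "continuous_on {0..4 * \<rho>} (\<lambda>r. g (x + r *\<^sub>R z))"
    by (intro continuous_on_compose2[OF cont] continuous_intros) auto
  have "((\<lambda>r. g (x + r *\<^sub>R z) \<bullet> z) has_integral \<psi> (x + (4 * \<rho>) *\<^sub>R z) - \<psi> (x + 0 *\<^sub>R z)) {0..4 * \<rho>}"
  proof (rule fundamental_theorem_of_calculus)
    fix r
    have "((\<lambda>r. \<psi> (x + r *\<^sub>R z)) has_derivative (\<lambda>h. g (x + r *\<^sub>R z) \<bullet> (h *\<^sub>R z))) (at r within {0..4 * \<rho>})"
      by (rule has_derivative_compose[where f="\<lambda>r. x + r *\<^sub>R z" and f'="\<lambda>h. h *\<^sub>R z", OF _ der])
        (auto intro!: derivative_eq_intros)
    then show "((\<lambda>r. \<psi> (x + r *\<^sub>R z)) has_vector_derivative g (x + r *\<^sub>R z) \<bullet> z) (at r within {0..4 * \<rho>})"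
      by (simp add: has_vector_derivative_def mult.commute)
  qed (use \<rho> in auto)
  moreover have "\<psi> (x + (4 * \<rho>) *\<^sub>R z) = 0"
  proof (rule supp)
    have "norm ((4 * \<rho>) *\<^sub>R z) \<le> norm (x + (4 * \<rho>) *\<^sub>R z) + norm x"
      by (metis add_diff_cancel_left' norm_triangle_ineq4)
    moreover have "norm ((4 * \<rho>) *\<^sub>R z) \<ge> 2 * \<rho>" using \<rho> z' by simp
    ultimately show "\<rho> \<le> norm (x + (4 * \<rho>) *\<^sub>R z)" using x by linarith
  qed
  ultimately have int: "((\<lambda>r. g (x + r *\<^sub>R z) \<bullet> z) has_integral - \<psi> x) {0..4 * \<rho>}"
    by simp
  have intn: "(\<lambda>r. norm (g (x + r *\<^sub>R z))) integrable_on {0..4 * \<rho>}"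
    by (intro integrable_continuous_interval continuous_on_norm cont_r)
  have "\<bar>\<psi> x\<bar> = norm (integral {0..4 * \<rho>} (\<lambda>r. g (x + r *\<^sub>R z) \<bullet> z))"
    using integral_unique[OF int] by simp
  also have "\<dots> \<le> integral {0..4 * \<rho>} (\<lambda>r. norm (g (x + r *\<^sub>R z)))"
  proof (rule Henstock_Kurzweil_Integration.integral_norm_bound_integral)
    fix r
    have "norm (g (x + r *\<^sub>R z) \<bullet> z) \<le> norm (g (x + r *\<^sub>R z)) * norm z"
      using Cauchy_Schwarz_ineq2 by auto
    also have "\<dots> \<le> norm (g (x + r *\<^sub>R z))"
      using z' by (simp add: mult_left_le)
    finally show "norm (g (x + r *\<^sub>R z) \<bullet> z) \<le> norm (g (x + r *\<^sub>R z))" .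
  qed (use int intn in auto)
  finally have "ennreal \<bar>\<psi> x\<bar> \<le> ennreal (integral {0..4 * \<rho>} (\<lambda>r. norm (g (x + r *\<^sub>R z))))"
    by (rule ennreal_leI)
  also have "\<dots> = (\<integral>\<^sup>+r\<in>{0..4 * \<rho>}. ennreal (norm (g (x + r *\<^sub>R z))) \<partial>lborel)"
    using nn_integral_has_integral_lebesgue'[of "{0..4 * \<rho>}" "\<lambda>r. norm (g (x + r *\<^sub>R z))", OF _ integrable_integral[OF intn]] by simp
  finally show ?thesis .
qed

text \<open>Polar coordinates as an inequality. For fixed \<open>r\<close>, substituting
  \<open>y = r *\<^sub>R z\<close> replaces the power of \<open>r\<close> by the kernel
  \<open>?k\<close>, which is \<open>1 / r\<close> when \<open>y / r\<close> lies in the annulus.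
  For fixed \<open>y\<close> this confines \<open>r\<close> to an interval from
  \<open>norm y\<close> to \<open>2 * norm y\<close>, on which \<open>1 / r\<close> is at most
  \<open>1 / norm y\<close>; hence the kernel has integral at most 1 in \<open>r\<close>.\<close>

lemma annulus_polar_le:
  fixes f :: "'a::euclidean_space \<Rightarrow> ennreal"
  assumes [measurable]: "f \<in> borel_measurable borel"
  shows "(\<integral>\<^sup>+z\<in>annulus. (\<integral>\<^sup>+r\<in>{0<..}. ennreal (r ^ (DIM('a) - 1)) * f (x + r *\<^sub>R z) \<partial>lborel) \<partial>lborel)
    \<le> (\<integral>\<^sup>+y. f y \<partial>lborel)"
proof -
  let ?k = "\<lambda>r y. ennreal (1 / r) * indicator annulus ((1 / r) *\<^sub>R y) * indicator {0<..} (r::real)"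
  have "(\<integral>\<^sup>+z\<in>annulus. (\<integral>\<^sup>+r\<in>{0<..}. ennreal (r ^ (DIM('a) - 1)) * f (x + r *\<^sub>R z) \<partial>lborel) \<partial>lborel)
      = (\<integral>\<^sup>+z. (\<integral>\<^sup>+r. ennreal (r ^ (DIM('a) - 1)) * f (x + r *\<^sub>R z) * indicator {0<..} r * indicator annulus z \<partial>lborel) \<partial>lborel)"
    by (intro nn_integral_cong nn_integral_multc[symmetric]) auto
  also have "\<dots> = (\<integral>\<^sup>+r. (\<integral>\<^sup>+z. ennreal (r ^ (DIM('a) - 1)) * f (x + r *\<^sub>R z) * indicator {0<..} r * indicator annulus z \<partial>lborel) \<partial>lborel)"
    by (rule lborel_pair.Fubini') measurable
  also have "\<dots> = (\<integral>\<^sup>+r. (\<integral>\<^sup>+y. f (x + y) * ?k r y \<partial>lborel) \<partial>lborel)"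
  proof (rule nn_integral_cong)
    fix r :: real
    show "(\<integral>\<^sup>+z. ennreal (r ^ (DIM('a) - 1)) * f (x + r *\<^sub>R z) * indicator {0<..} r * indicator annulus z \<partial>lborel)
        = (\<integral>\<^sup>+y. f (x + y) * ?k r y \<partial>lborel)"
    proof (cases "r > 0")
      case True
      have "(\<integral>\<^sup>+y. f (x + y) * ?k r y \<partial>lborel)
          = ennreal (r ^ DIM('a)) * (\<integral>\<^sup>+z. f (x + r *\<^sub>R z) * ?k r (r *\<^sub>R z) \<partial>lborel)"
        using True by (intro nn_integral_lborel_scaleR) auto
      also have "\<dots> = (\<integral>\<^sup>+z. ennreal (r ^ DIM('a)) * (f (x + r *\<^sub>R z) * ?k r (r *\<^sub>R z)) \<partial>lborel)"
        by (rule nn_integral_cmult[symmetric]) auto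
      also have "\<dots> = (\<integral>\<^sup>+z. ennreal (r ^ (DIM('a) - 1)) * f (x + r *\<^sub>R z) * indicator {0<..} r * indicator annulus z \<partial>lborel)"
      proof (rule nn_integral_cong)
        fix z :: 'a
        have "r ^ DIM('a) * (1 / r) = r ^ (DIM('a) - 1)"
          using True by (simp add: power_diff)
        then have "ennreal (r ^ DIM('a)) * ennreal (1 / r) = ennreal (r ^ (DIM('a) - 1))"
          using True by (simp add: ennreal_mult''[symmetric])
        moreover have "ennreal (r ^ DIM('a)) * (f (x + r *\<^sub>R z) * ?k r (r *\<^sub>R z))
          = (ennreal (r ^ DIM('a)) * ennreal (1 / r)) * f (x + r *\<^sub>R z) * indicator annulus z"
          using True by (simp add: mult_ac)
        ultimately show "ennreal (r ^ DIM('a)) * (f (x + r *\<^sub>R z) * ?k r (r *\<^sub>R z))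
          = ennreal (r ^ (DIM('a) - 1)) * f (x + r *\<^sub>R z) * indicator {0<..} r * indicator annulus z"
          using True by simp
      qed
      finally show ?thesis ..
    qed simp
  qed
  also have "\<dots> = (\<integral>\<^sup>+y. (\<integral>\<^sup>+r. f (x + y) * ?k r y \<partial>lborel) \<partial>lborel)"
    by (rule lborel_pair.Fubini') measurable
  also have "\<dots> \<le> (\<integral>\<^sup>+y. f (x + y) \<partial>lborel)"
  proof (rule nn_integral_mono)
    fix y :: 'a
    have "(\<integral>\<^sup>+r. ?k r y \<partial>lborel) \<le> (\<integral>\<^sup>+r. ennreal (1 / norm y) * indicator {norm y..2 * norm y} r \<partial>lborel)"
    proof (rule nn_integral_mono)
      fix r :: real
      show "?k r y \<le> ennreal (1 / norm y) * indicator {norm y..2 * norm y} r"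
      proof (cases "r > 0 \<and> (1 / r) *\<^sub>R y \<in> annulus")
        case True
        then have "norm y < r" "r < 2 * norm y" by (auto simp: annulus_def field_simps)
        moreover from this have "norm y > 0" by linarith
        ultimately show ?thesis using True
          by (auto simp: indicator_def intro!: ennreal_leI divide_left_mono)
      qed (auto simp: indicator_def)
    qed
    also have "\<dots> = ennreal (1 / norm y) * ennreal (norm y)"
      by (simp add: nn_integral_cmult)
    also have "\<dots> \<le> 1"
      by (cases "y = 0") (auto simp: ennreal_mult'[symmetric])
    finally have "f (x + y) * (\<integral>\<^sup>+r. ?k r y \<partial>lborel) \<le> f (x + y) * 1"
      by (intro mult_left_mono) auto
    then show "(\<integral>\<^sup>+r. f (x + y) * ?k r y \<partial>lborel) \<le> f (x + y)"
      by (subst nn_integral_cmult) auto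
  qed
  also have "\<dots> = (\<integral>\<^sup>+y. f y \<partial>lborel)"
    by (rule nn_integral_lborel_shift) simp
  finally show ?thesis .
qed

section \<open>Exponential decay of level sets for compactly supported functions\<close>

text \<open>The parameter \<open>\<tau>\<close> balances the two parts. Beyond the cut, the
  inequality \<open>young\<close> splits the gradient into a term controlled by the energy bound
  \<open>G\<close> and the term \<open>\<tau> / r\<close>; each contributes at most
  \<open>a * t / 4\<close>. Half of the level is left for the part before the cut, whose integral is
  proportional to \<open>\<delta>\<close> and so exponentially small in \<open>t / \<tau>\<close>;
  Markov's inequality concludes.\<close>

lemma weak_type_exponential_estimate:
  fixes \<psi> :: "'a::euclidean_space \<Rightarrow> real"
  defines "a \<equiv> measure lborel (annulus :: 'a set)" and "n \<equiv> DIM('a)"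
  assumes n: "n \<ge> 2"
    and der: "\<And>x. (\<psi> has_derivative (\<lambda>h. g x \<bullet> h)) (at x)"
    and cont: "continuous_on UNIV g"
    and supp: "\<And>x. \<rho> \<le> norm x \<Longrightarrow> \<psi> x = 0"
    and \<rho>: "\<rho> > 0" and t: "t > 0" and \<tau>: "\<tau> > 0"
    and G: "(\<integral>\<^sup>+x. ennreal (norm (g x) ^ n) \<partial>lborel) \<le> ennreal (a * t * \<tau> ^ (n - 1) / 4)"
  shows "emeasure lborel {x. t \<le> \<bar>\<psi> x\<bar>}
    \<le> ennreal (8 * \<rho> * exp (- t / (4 * \<tau>)) / t) * (\<integral>\<^sup>+x. ennreal (norm (g x)) \<partial>lborel)"
proof -
  define D where "D = 4 * \<rho>"
  \<comment> \<open>This cut makes the integral of \<open>\<tau> / r\<close> over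
    \<open>{\<delta>..D}\<close> equal to \<open>\<tau> * ln (D / \<delta>) = t / 4\<close>.\<close>
  define \<delta> where "\<delta> = D * exp (- t / (4 * \<tau>))"
  have D: "D > 0" and \<delta>: "0 < \<delta>" "\<delta> \<le> D"
    using \<rho> t \<tau> by (auto simp: D_def \<delta>_def mult_left_le)
  have a: "a > 0" unfolding a_def by (rule measure_annulus_pos)
  have ea: "emeasure lborel (annulus :: 'a set) = ennreal a"
    unfolding a_def using emeasure_annulus_finite[where 'a='a]
    by (intro emeasure_eq_ennreal_measure) auto
  have [measurable]: "g \<in> borel_measurable borel"
    using cont by (rule borel_measurable_continuous_onI)
  have [measurable]: "\<psi> \<in> borel_measurable borel"
    using der by (intro borel_measurable_continuous_onI)
      (metis continuous_at_imp_continuous_on has_derivative_continuous)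
  \<comment> \<open>The near and far parts are integrals over the directions, not divided by the
    measure \<open>a\<close>; their sum therefore bounds \<open>a\<close> times the absolute value
    of \<open>\<psi> x\<close>.\<close>
  define N where "N x = (\<integral>\<^sup>+z\<in>annulus. (\<integral>\<^sup>+r\<in>{0..<\<delta>}. ennreal (norm (g (x + r *\<^sub>R z))) \<partial>lborel) \<partial>lborel)" for x
  define P where "P x = (\<integral>\<^sup>+z\<in>annulus. (\<integral>\<^sup>+r\<in>{\<delta>..D}. ennreal (norm (g (x + r *\<^sub>R z))) \<partial>lborel) \<partial>lborel)" for x
  have N_meas [measurable]: "N \<in> borel_measurable borel"
    unfolding N_def by measurable
  have split: "ennreal (a * \<bar>\<psi> x\<bar>) \<le> N x + P x" if "norm x < \<rho>" for x
  proof -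
    have "ennreal (a * \<bar>\<psi> x\<bar>) = (\<integral>\<^sup>+z\<in>annulus. ennreal \<bar>\<psi> x\<bar> \<partial>(lborel :: 'a measure))"
      using a by (subst nn_integral_cmult_indicator) (auto simp: ea ennreal_mult mult.commute)
    also have "\<dots> \<le> (\<integral>\<^sup>+z\<in>annulus. (\<integral>\<^sup>+r\<in>{0..D}. ennreal (norm (g (x + r *\<^sub>R z))) \<partial>lborel) \<partial>lborel)"
      using abs_le_ray_integral[OF der cont supp that]
      by (intro nn_integral_mono) (auto simp: D_def indicator_def)
    also have "\<dots> = (\<integral>\<^sup>+z. ((\<integral>\<^sup>+r\<in>{0..<\<delta>}. ennreal (norm (g (x + r *\<^sub>R z))) \<partial>lborel)
          + (\<integral>\<^sup>+r\<in>{\<delta>..D}. ennreal (norm (g (x + r *\<^sub>R z))) \<partial>lborel)) * indicator annulus z \<partial>lborel)"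
    proof (rule nn_integral_cong, rule arg_cong2[where f="(*)"])
      fix z :: 'a
      show "(\<integral>\<^sup>+r\<in>{0..D}. ennreal (norm (g (x + r *\<^sub>R z))) \<partial>lborel)
        = (\<integral>\<^sup>+r\<in>{0..<\<delta>}. ennreal (norm (g (x + r *\<^sub>R z))) \<partial>lborel)
          + (\<integral>\<^sup>+r\<in>{\<delta>..D}. ennreal (norm (g (x + r *\<^sub>R z))) \<partial>lborel)"
        using \<delta> by (subst nn_integral_add[symmetric])
          (auto intro!: nn_integral_cong simp: indicator_def)
    qed simp
    also have "\<dots> = N x + P x"
      unfolding N_def P_def by (subst nn_integral_add[symmetric]) (auto simp: distrib_right)
    finally show ?thesis .
  qed
  have inv_r: "(\<integral>\<^sup>+r\<in>{\<delta>..D}. ennreal (\<tau> / r) \<partial>lborel) = ennreal (t / 4)"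
  proof -
    have "(\<integral>\<^sup>+r\<in>{\<delta>..D}. ennreal (\<tau> / r) \<partial>lborel) = ennreal (\<tau> * ln D - \<tau> * ln \<delta>)"
      using \<delta> \<tau> by (intro nn_integral_FTC_Icc) (auto intro!: derivative_eq_intros)
    also have "\<tau> * ln D - \<tau> * ln \<delta> = t / 4"
      using D \<tau> by (simp add: \<delta>_def ln_mult field_simps)
    finally show ?thesis .
  qed
  have far: "P x \<le> ennreal (a * t / 2)" for x
  proof -
    let ?f = "\<lambda>y. ennreal (norm (g y) ^ n)"
    let ?Q = "\<lambda>z. (\<integral>\<^sup>+r\<in>{0<..}. ennreal (r ^ (n - 1)) * ?f (x + r *\<^sub>R z) \<partial>lborel)"
    \<comment> \<open>Either \<open>X \<le> \<tau> / r\<close> or \<open>(r X / \<tau>)\<^bsup>n-1\<^esup> \<ge> 1\<close>; the powers of \<open>r\<close> suit polar coordinates.\<close>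
    have young: "X \<le> (1 / \<tau> ^ (n - 1)) * (r ^ (n - 1) * X ^ n) + \<tau> / r" if "X \<ge> 0" "r > 0" for X r :: real
    proof (cases "X \<le> \<tau> / r")
      case True
      then show ?thesis using that \<tau> by (simp add: add_increasing)
    next
      case False
      then have "1 \<le> (r * X / \<tau>) ^ (n - 1)"
        using that \<tau> by (intro one_le_power) (simp add: field_simps)
      then have "X * 1 \<le> X * (r * X / \<tau>) ^ (n - 1)"
        using that by (intro mult_left_mono) auto
      also have "\<dots> = (1 / \<tau> ^ (n - 1)) * (r ^ (n - 1) * (X * X ^ (n - 1)))"
        by (simp add: power_mult_distrib power_divide)
      also have "X * X ^ (n - 1) = X ^ n"
        using n by (simp flip: power_Suc)
      finally show ?thesis using that \<tau> by (simp add: add_increasing2)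
    qed
    have inner: "(\<integral>\<^sup>+r\<in>{\<delta>..D}. ennreal (norm (g (x + r *\<^sub>R z))) \<partial>lborel)
        \<le> ennreal (1 / \<tau> ^ (n - 1)) * ?Q z + ennreal (t / 4)" for z
    proof -
      have "(\<integral>\<^sup>+r\<in>{\<delta>..D}. ennreal (norm (g (x + r *\<^sub>R z))) \<partial>lborel)
        \<le> (\<integral>\<^sup>+r. ennreal (1 / \<tau> ^ (n - 1)) * (ennreal (r ^ (n - 1)) * ?f (x + r *\<^sub>R z) * indicator {0<..} r)
            + ennreal (\<tau> / r) * indicator {\<delta>..D} r \<partial>lborel)"
      proof (rule nn_integral_mono)
        fix r :: real
        let ?X = "norm (g (x + r *\<^sub>R z))"
        show "ennreal ?X * indicator {\<delta>..D} r
          \<le> ennreal (1 / \<tau> ^ (n - 1)) * (ennreal (r ^ (n - 1)) * ?f (x + r *\<^sub>R z) * indicator {0<..} r)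
            + ennreal (\<tau> / r) * indicator {\<delta>..D} r"
        proof (cases "r \<in> {\<delta>..D}")
          case True
          then have r: "r > 0" using \<delta> by auto
          have "ennreal ?X \<le> ennreal ((1 / \<tau> ^ (n - 1)) * (r ^ (n - 1) * ?X ^ n) + \<tau> / r)"
            using r by (intro ennreal_leI young) auto
          also have "\<dots> = ennreal (1 / \<tau> ^ (n - 1)) * (ennreal (r ^ (n - 1)) * ?f (x + r *\<^sub>R z)) + ennreal (\<tau> / r)"
            using r \<tau> by (simp add: ennreal_plus ennreal_mult del: times_divide_eq_left)
          finally show ?thesis using True r by simp
        qed simp
      qed
      also have "\<dots> = ennreal (1 / \<tau> ^ (n - 1)) * ?Q z + ennreal (t / 4)"
        by (subst nn_integral_add) (auto simp: nn_integral_cmult inv_r)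
      finally show ?thesis .
    qed
    have "P x \<le> (\<integral>\<^sup>+z. ennreal (1 / \<tau> ^ (n - 1)) * (?Q z * indicator annulus z)
        + ennreal (t / 4) * indicator annulus z \<partial>lborel)"
      unfolding P_def
    proof (rule nn_integral_mono)
      fix z :: 'a
      show "(\<integral>\<^sup>+r\<in>{\<delta>..D}. ennreal (norm (g (x + r *\<^sub>R z))) \<partial>lborel) * indicator annulus z
        \<le> ennreal (1 / \<tau> ^ (n - 1)) * (?Q z * indicator annulus z) + ennreal (t / 4) * indicator annulus z"
        using inner[of z] by (cases "z \<in> annulus") auto
    qed
    also have "\<dots> = ennreal (1 / \<tau> ^ (n - 1)) * (\<integral>\<^sup>+z\<in>annulus. ?Q z \<partial>lborel) + ennreal (t / 4) * ennreal a"
      by (subst nn_integral_add) (auto simp: nn_integral_cmult nn_integral_cmult_indicator ea)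
    also have "\<dots> \<le> ennreal (1 / \<tau> ^ (n - 1)) * ennreal (a * t * \<tau> ^ (n - 1) / 4) + ennreal (t / 4) * ennreal a"
    proof (intro add_mono mult_left_mono order_refl)
      have "(\<integral>\<^sup>+z\<in>annulus. ?Q z \<partial>lborel) \<le> (\<integral>\<^sup>+y. ?f y \<partial>lborel)"
        unfolding n_def by (rule annulus_polar_le) measurable
      with G show "(\<integral>\<^sup>+z\<in>annulus. ?Q z \<partial>lborel) \<le> ennreal (a * t * \<tau> ^ (n - 1) / 4)" by simp
    qed auto
    also have "\<dots> = ennreal ((1 / \<tau> ^ (n - 1)) * (a * t * \<tau> ^ (n - 1) / 4) + t / 4 * a)"
      using a t \<tau> by (simp add: ennreal_mult[symmetric] ennreal_plus[symmetric] del: ennreal_plus)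
    also have "(1 / \<tau> ^ (n - 1)) * (a * t * \<tau> ^ (n - 1) / 4) + t / 4 * a = a * t / 2"
      using \<tau> by (simp add: field_simps)
    finally show ?thesis .
  qed
  have shift: "(\<integral>\<^sup>+x. ennreal (norm (g (x + c))) \<partial>lborel) = (\<integral>\<^sup>+x. ennreal (norm (g x)) \<partial>lborel)" for c
    using nn_integral_lborel_shift[of "\<lambda>x. ennreal (norm (g x))" c] by (simp add: add.commute)
  \<comment> \<open>After exchanging the integrals, translation invariance gives the same L^1 norm
    of \<open>g\<close> for every \<open>r\<close> and \<open>z\<close>; the two ranges contribute
    the factors \<open>\<delta>\<close> and \<open>a\<close>.\<close>
  have near: "(\<integral>\<^sup>+x. N x \<partial>lborel) = ennreal (a * \<delta>) * (\<integral>\<^sup>+x. ennreal (norm (g x)) \<partial>lborel)"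
  proof -
    have "(\<integral>\<^sup>+x. N x \<partial>lborel)
      = (\<integral>\<^sup>+z. (\<integral>\<^sup>+x. (\<integral>\<^sup>+r\<in>{0..<\<delta>}. ennreal (norm (g (x + r *\<^sub>R z))) \<partial>lborel) * indicator annulus z \<partial>lborel) \<partial>lborel)"
      unfolding N_def by (rule lborel_pair.Fubini') measurable
    also have "\<dots> = (\<integral>\<^sup>+z\<in>annulus. (\<integral>\<^sup>+x. (\<integral>\<^sup>+r\<in>{0..<\<delta>}. ennreal (norm (g (x + r *\<^sub>R z))) \<partial>lborel) \<partial>lborel) \<partial>lborel)"
      by (intro nn_integral_cong nn_integral_multc) measurable
    also have "\<dots> = (\<integral>\<^sup>+z\<in>annulus. (ennreal \<delta> * (\<integral>\<^sup>+x. ennreal (norm (g x)) \<partial>lborel)) \<partial>(lborel :: 'a measure))"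
    proof (rule nn_integral_cong, rule arg_cong2[where f="(*)"])
      fix z :: 'a
      have "(\<integral>\<^sup>+x. (\<integral>\<^sup>+r\<in>{0..<\<delta>}. ennreal (norm (g (x + r *\<^sub>R z))) \<partial>lborel) \<partial>lborel)
        = (\<integral>\<^sup>+r. (\<integral>\<^sup>+x. ennreal (norm (g (x + r *\<^sub>R z))) * indicator {0..<\<delta>} r \<partial>lborel) \<partial>lborel)"
        by (rule lborel_pair.Fubini') measurable
      also have "\<dots> = (\<integral>\<^sup>+r\<in>{0..<\<delta>}. (\<integral>\<^sup>+x. ennreal (norm (g (x + r *\<^sub>R z))) \<partial>lborel) \<partial>lborel)"
        by (intro nn_integral_cong nn_integral_multc) measurable
      also have "\<dots> = (\<integral>\<^sup>+r\<in>{0..<\<delta>}. (\<integral>\<^sup>+x. ennreal (norm (g x)) \<partial>lborel) \<partial>(lborel :: real measure))"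
        by (simp add: shift)
      also have "\<dots> = ennreal \<delta> * (\<integral>\<^sup>+x. ennreal (norm (g x)) \<partial>lborel)"
        using \<delta> by (subst nn_integral_cmult_indicator) (auto simp: mult.commute)
      finally show "(\<integral>\<^sup>+x. (\<integral>\<^sup>+r\<in>{0..<\<delta>}. ennreal (norm (g (x + r *\<^sub>R z))) \<partial>lborel) \<partial>lborel)
        = ennreal \<delta> * (\<integral>\<^sup>+x. ennreal (norm (g x)) \<partial>lborel)" .
    qed simp
    also have "\<dots> = ennreal (a * \<delta>) * (\<integral>\<^sup>+x. ennreal (norm (g x)) \<partial>lborel)"
      using a \<delta> by (subst nn_integral_cmult_indicator) (auto simp: ea ennreal_mult mult_ac)
    finally show ?thesis .
  qed
  \<comment> \<open>At such a point \<open>N x + P x\<close> is at least \<open>a * t\<close>, and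
    \<open>far\<close> bounds \<open>P x\<close> by half of that. Cancelling this half in
    \<open>ennreal\<close> is sound because it is finite.\<close>
  have "{x. t \<le> \<bar>\<psi> x\<bar>} \<subseteq> {x \<in> UNIV. 1 \<le> ennreal (2 / (a * t)) * N x}"
  proof safe
    fix x assume x: "t \<le> \<bar>\<psi> x\<bar>"
    then have "norm x < \<rho>" using supp[of x] t by fastforce
    from split[OF this] have "ennreal (a * t) \<le> N x + ennreal (a * t / 2)"
      by (rule order_trans[OF order_trans[rotated]])
        (use a x far[of x] in \<open>auto intro!: ennreal_leI add_left_mono\<close>)
    moreover have "ennreal (a * t) = ennreal (a * t / 2) + ennreal (a * t / 2)"
      using a t by (subst ennreal_plus[symmetric]) auto
    ultimately have "ennreal (a * t / 2) + ennreal (a * t / 2) \<le> ennreal (a * t / 2) + N x"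
      by (simp only: add.commute)
    then have "ennreal (a * t / 2) \<le> N x"
      unfolding ennreal_add_left_cancel_le by simp
    then have "ennreal (2 / (a * t)) * ennreal (a * t / 2) \<le> ennreal (2 / (a * t)) * N x"
      by (rule mult_left_mono) simp
    then show "1 \<le> ennreal (2 / (a * t)) * N x"
      using a t by (simp add: ennreal_mult[symmetric])
  qed auto
  then have "emeasure lborel {x. t \<le> \<bar>\<psi> x\<bar>} \<le> emeasure lborel {x \<in> UNIV. 1 \<le> ennreal (2 / (a * t)) * N x}"
    by (rule emeasure_mono) measurable
  also have "\<dots> \<le> ennreal (2 / (a * t)) * (\<integral>\<^sup>+x. N x * indicator UNIV x \<partial>lborel)"
    by (rule nn_integral_Markov_inequality) auto
  also have "\<dots> = ennreal (2 / (a * t) * (a * \<delta>)) * (\<integral>\<^sup>+x. ennreal (norm (g x)) \<partial>lborel)"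
    using a t \<delta> by (simp add: near ennreal_mult mult.assoc del: times_divide_eq_left)
  also have "2 / (a * t) * (a * \<delta>) = 8 * \<rho> * exp (- t / (4 * \<tau>)) / t"
    using a by (simp add: \<delta>_def D_def)
  finally show ?thesis .
qed

section \<open>Gradients and supports of smooth test functions\<close>

text \<open>Linearity and the expansion in the standard basis recover the whole derivative from its
  coordinates, in the inner product form that integration along rays uses.\<close>

lemma has_derivative_grad:
  assumes "f differentiable (at x)"
  shows "(f has_derivative (\<lambda>h. grad f x \<bullet> h)) (at x)"
proof -
  let ?D = "frechet_derivative f (at x)"
  have lin: "linear ?D" by (rule linear_frechet_derivative[OF assms])
  have "?D h = grad f x \<bullet> h" for h
  proof -
    have "?D h = ?D (\<Sum>i\<in>UNIV. h $ i *\<^sub>R axis i 1)"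
      using basis_expansion[of h] by (simp add: scalar_mult_eq_scaleR)
    also have "\<dots> = grad f x \<bullet> h"
      by (simp add: linear_sum[OF lin] linear_scale[OF lin] grad_def inner_vec_def mult.commute)
    finally show ?thesis .
  qed
  then have "?D = (\<lambda>h. grad f x \<bullet> h)" by blast
  then show ?thesis
    using frechet_derivative_works[THEN iffD1, OF assms] by simp
qed

lemma Cinfc_differentiable: "\<phi> \<in> Cinfc \<Omega> \<Longrightarrow> \<phi> differentiable (at x)"
  by (auto simp: Cinfc_def dest!: spec[of _ 1])

lemma Cinfc_continuous: "\<phi> \<in> Cinfc \<Omega> \<Longrightarrow> continuous_on UNIV \<phi>"
  by (auto simp: Cinfc_def dest!: spec[of _ 0])

lemma Cinfc_continuous_grad:
  assumes "\<phi> \<in> Cinfc \<Omega>"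
  shows "continuous_on UNIV (grad \<phi>)"
proof -
  have "Ck_on 1 \<phi> UNIV" using assms by (auto simp: Cinfc_def)
  then have "continuous_on UNIV (\<lambda>x. \<chi> i. grad \<phi> x $ i)"
    by (intro continuous_on_vec_lambda) simp
  then show ?thesis by simp
qed

text \<open>Off the closure, \<open>f\<close> agrees with the zero function on an open neighbourhood
  of \<open>x\<close>.\<close>

lemma grad_eq_0_off_support:
  assumes "x \<notin> closure {x. f x \<noteq> 0}"
  shows "grad f x = 0"
proof -
  have "(f has_derivative (\<lambda>h. 0)) (at x)"
    by (rule has_derivative_transform_within_open[where s="- closure {x. f x \<noteq> 0}" and f="\<lambda>_. 0"])
      (use assms closure_subset[of "{x. f x \<noteq> 0}"] in \<open>auto\<close>)
  then have "frechet_derivative f (at x) = (\<lambda>h. 0)"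
    by (rule frechet_derivative_at[symmetric])
  then show ?thesis by (simp add: grad_def vec_eq_iff)
qed

text \<open>Having a single compact set for the function and its gradient gives boundedness of both,
  and lets integrals of gradients over the whole space be taken over
  \<open>\<Omega>\<close>.\<close>

lemma Cinfc_support:
  assumes "\<phi> \<in> Cinfc \<Omega>"
  obtains K where "compact K" "K \<subseteq> \<Omega>" "\<And>x. x \<notin> K \<Longrightarrow> \<phi> x = 0" "\<And>x. x \<notin> K \<Longrightarrow> grad \<phi> x = 0"
proof
  show "compact (closure {x. \<phi> x \<noteq> 0})" "closure {x. \<phi> x \<noteq> 0} \<subseteq> \<Omega>"
    using assms by (auto simp: Cinfc_def compactly_supported_in_def)
  show "\<phi> x = 0" if "x \<notin> closure {x. \<phi> x \<noteq> 0}" for x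
    using that closure_subset[of "{x. \<phi> x \<noteq> 0}"] by blast
qed (rule grad_eq_0_off_support)

lemma bounded_continuous_compact_support:
  fixes f :: "'a::topological_space \<Rightarrow> 'b::real_normed_vector"
  assumes "continuous_on UNIV f" "compact K" "\<And>x. x \<notin> K \<Longrightarrow> f x = 0"
  obtains B where "\<And>x. norm (f x) \<le> B"
proof -
  have "compact (f ` K)"
    using assms by (meson compact_continuous_image continuous_on_subset subset_UNIV)
  then obtain B where "\<And>y. y \<in> f ` K \<Longrightarrow> norm y \<le> B"
    by (meson bounded_iff compact_imp_bounded)
  then have "norm (f x) \<le> max B 0" for x
    using assms(3)[of x] by (cases "x \<in> K") (auto simp: le_max_iff_disj)
  then show ?thesis by (rule that)
qed

section \<open>Elementary L^p bounds\<close>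

text \<open>The sum is at most twice the larger term, whose power is one of the two on the right.
  The constant is not optimal, but it takes no convexity and covers \<open>p = 0\<close>.\<close>

lemma power_add_le_two_power:
  fixes a b :: real
  assumes "0 \<le> a" "0 \<le> b"
  shows "(a + b) ^ p \<le> 2 ^ p * (a ^ p + b ^ p)"
proof -
  have "(a + b) ^ p \<le> (2 * max a b) ^ p"
    using assms by (intro power_mono) auto
  also have "\<dots> = 2 ^ p * max a b ^ p" by (rule power_mult_distrib)
  also have "max a b ^ p \<le> a ^ p + b ^ p"
    using assms by (auto simp: max_def)
  finally show ?thesis by simp
qed

text \<open>\<open>c\<close> plays the role of a common limit: closeness to it controls the distance
  between two approximants. With \<open>c = 0\<close> the bound shows that \<open>Lp\<close> is
  closed under differences.\<close>

lemma power_norm_diff_le: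
  fixes a b c :: "'a::real_normed_vector"
  shows "norm (a - b) ^ p \<le> 2 ^ p * (norm (a - c) ^ p + norm (b - c) ^ p)"
proof -
  have "norm (a - b) \<le> norm (a - c) + norm (b - c)"
    using norm_triangle_ineq4[of "a - c" "b - c"] by simp
  then have "norm (a - b) ^ p \<le> (norm (a - c) + norm (b - c)) ^ p"
    by (intro power_mono) auto
  also have "\<dots> \<le> 2 ^ p * (norm (a - c) ^ p + norm (b - c) ^ p)"
    by (rule power_add_le_two_power) auto
  finally show ?thesis .
qed

lemma Lp_diff:
  assumes f: "f \<in> Lp p \<Omega>" and g: "g \<in> Lp p \<Omega>"
  shows "(\<lambda>x. f x - g x) \<in> Lp p \<Omega>"
proof -
  have [measurable]: "f \<in> borel_measurable (lebesgue_on \<Omega>)" "g \<in> borel_measurable (lebesgue_on \<Omega>)"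
    using f g by (auto simp: Lp_def)
  have "integrable (lebesgue_on \<Omega>) (\<lambda>x. norm (f x - g x) ^ p)"
  proof (rule Bochner_Integration.integrable_bound)
    show "integrable (lebesgue_on \<Omega>) (\<lambda>x. 2 ^ p * (norm (f x) ^ p + norm (g x) ^ p))"
      using f g by (auto simp: Lp_def)
    show "AE x in lebesgue_on \<Omega>. norm (norm (f x - g x) ^ p) \<le> norm (2 ^ p * (norm (f x) ^ p + norm (g x) ^ p))"
      using power_norm_diff_le[of _ _ p 0] by (intro always_eventually) auto
  qed measurable
  then show ?thesis by (auto simp: Lp_def)
qed

lemma Lp_continuous_bounded:
  fixes f :: "real^'n \<Rightarrow> 'b::{banach,second_countable_topology}"
  assumes "continuous_on UNIV f" "\<And>x. norm (f x) \<le> B" "open \<Omega>" "bounded \<Omega>"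
  shows "f \<in> Lp p \<Omega>"
proof -
  have \<Omega>: "\<Omega> \<in> lmeasurable" using assms by (simp add: lmeasurable_open)
  interpret finite_measure "lebesgue_on \<Omega>"
    by (rule finite_measure_lebesgue_on[OF \<Omega>])
  have "f \<in> borel_measurable borel"
    using assms by (intro borel_measurable_continuous_onI)
  then have f: "f \<in> borel_measurable (lebesgue_on \<Omega>)"
    by (intro measurable_restrict_space1 measurable_completion) simp
  then have "integrable (lebesgue_on \<Omega>) (\<lambda>x. norm (f x) ^ p)"
    using assms(2) by (intro integrable_const_bound[where B="B ^ p"]) (auto intro!: power_mono)
  with f show ?thesis by (auto simp: Lp_def)
qed

section \<open>From exponential tails to exponential integrability\<close>

text \<open>Slicing at the integers: where \<open>h\<close> lies between \<open>j\<close> and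
  \<open>j + 1\<close> the integrand is at most \<open>exp (c * (j + 1))\<close>, and the tail
  \<open>exp (- (c + 1) * j)\<close> leaves a geometric series of ratio
  \<open>exp (- 1)\<close>.\<close>

lemma nn_integral_exp_finite:
  assumes [measurable]: "h \<in> borel_measurable M" and c: "c \<ge> 0"
    and fin: "emeasure M (space M) < \<infinity>"
    and tail: "\<And>s. s \<ge> S \<Longrightarrow> emeasure M {x \<in> space M. s \<le> h x} \<le> ennreal (C * exp (- (c + 1) * s))"
  shows "(\<integral>\<^sup>+x. ennreal (exp (c * h x)) \<partial>M) < \<infinity>"
proof -
  define m where "m = measure M (space M)"
  have m: "emeasure M (space M) = ennreal m"
    unfolding m_def using fin by (intro emeasure_eq_ennreal_measure) auto
  have m0: "m \<ge> 0" by (simp add: m_def)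
  \<comment> \<open>Below the threshold \<open>S\<close> only the total mass \<open>m\<close> bounds
    the level sets. The enlarged constant makes the exponential bound at least \<open>m\<close>
    there, so that it holds at every level.\<close>
  define C' where "C' = max C (m * exp ((c + 1) * max S 0))"
  have C': "C' \<ge> 0" by (simp add: C'_def m0 le_max_iff_disj)
  have tail': "emeasure M {x \<in> space M. s \<le> h x} \<le> ennreal (C' * exp (- (c + 1) * s))" for s
  proof (cases "s \<ge> S")
    case True
    have "emeasure M {x \<in> space M. s \<le> h x} \<le> ennreal (C * exp (- (c + 1) * s))"
      by (rule tail) fact
    also have "\<dots> \<le> ennreal (C' * exp (- (c + 1) * s))"
      by (intro ennreal_leI mult_right_mono) (auto simp: C'_def)
    finally show ?thesis .
  next
    case False
    have "emeasure M {x \<in> space M. s \<le> h x} \<le> ennreal m"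
      unfolding m[symmetric] by (rule emeasure_mono) auto
    also have "m \<le> C' * exp (- (c + 1) * s)"
    proof -
      have "m * 1 \<le> m * exp ((c + 1) * (max S 0 - s))"
        using m0 c False by (intro mult_left_mono) auto
      also have "\<dots> = (m * exp ((c + 1) * max S 0)) * exp (- (c + 1) * s)"
        by (simp add: exp_add[symmetric] algebra_simps)
      also have "\<dots> \<le> C' * exp (- (c + 1) * s)"
        by (intro mult_right_mono) (auto simp: C'_def)
      finally show ?thesis by simp
    qed
    finally show ?thesis by (simp add: ennreal_leI)
  qed
  let ?A = "\<lambda>j. {x \<in> space M. real j \<le> h x}"
  \<comment> \<open>For nonnegative \<open>h x\<close> the single term indexed by the integer part
    suffices; the summand \<open>1\<close> takes care of negative \<open>h x\<close>.\<close>
  have pw: "ennreal (exp (c * h x)) \<le> 1 + (\<Sum>j. ennreal (exp (c * (real j + 1))) * indicator (?A j) x)"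
    if x: "x \<in> space M" for x
  proof (cases "h x \<ge> 0")
    case True
    define j where "j = nat \<lfloor>h x\<rfloor>"
    have j: "real j \<le> h x" "h x \<le> real j + 1" unfolding j_def using True by linarith+
    have ge_term: "f j \<le> (\<Sum>j. f j)" for f :: "nat \<Rightarrow> ennreal"
      using sum_le_suminf[of f "{j}"] by simp
    have "ennreal (exp (c * h x)) \<le> ennreal (exp (c * (real j + 1))) * indicator (?A j) x"
      using j x c by (auto intro!: ennreal_leI mult_left_mono)
    also have "\<dots> \<le> (\<Sum>j. ennreal (exp (c * (real j + 1))) * indicator (?A j) x)"
      using ge_term .
    finally show ?thesis by (simp add: add_increasing)
  next
    case False
    then have "exp (c * h x) \<le> 1" using c by (simp add: mult_nonneg_nonpos)
    then have "ennreal (exp (c * h x)) \<le> 1" by simp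
    then show ?thesis by (simp add: add_increasing2)
  qed
  have "(\<integral>\<^sup>+x. ennreal (exp (c * h x)) \<partial>M)
    \<le> (\<integral>\<^sup>+x. 1 + (\<Sum>j. ennreal (exp (c * (real j + 1))) * indicator (?A j) x) \<partial>M)"
    by (intro nn_integral_mono pw)
  also have "\<dots> = ennreal m + (\<Sum>j. ennreal (exp (c * (real j + 1))) * emeasure M (?A j))"
    by (simp add: nn_integral_add nn_integral_suminf nn_integral_cmult_indicator m)
  also have "\<dots> \<le> ennreal m + (\<Sum>j. ennreal (C' * exp c * exp (- 1) ^ j))"
  proof (intro add_left_mono suminf_le)
    fix j
    have "ennreal (exp (c * (real j + 1))) * emeasure M (?A j)
      \<le> ennreal (exp (c * (real j + 1))) * ennreal (C' * exp (- (c + 1) * real j))"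
      by (intro mult_left_mono tail') auto
    also have "\<dots> = ennreal (C' * (exp (c * (real j + 1)) * exp (- (c + 1) * real j)))"
      using C' by (simp add: ennreal_mult[symmetric] mult_ac)
    also have "exp (c * (real j + 1)) * exp (- (c + 1) * real j) = exp c * exp (- 1) ^ j"
      by (simp add: exp_of_nat_mult[symmetric] exp_add[symmetric] algebra_simps)
    finally show "ennreal (exp (c * (real j + 1))) * emeasure M (?A j) \<le> ennreal (C' * exp c * exp (- 1) ^ j)"
      by (simp add: mult.assoc)
  qed auto
  also have "(\<Sum>j. ennreal (C' * exp c * exp (- 1) ^ j)) = ennreal (\<Sum>j. C' * exp c * exp (- 1) ^ j)"
    using C' by (intro suminf_ennreal2 summable_mult summable_geometric) auto
  finally show ?thesis
    by (rule order.strict_trans1) (simp add: ennreal_add_less_top)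
qed

section \<open>Level sets of Sobolev functions with zero boundary values\<close>

lemma Cinfc_in_Lp:
  assumes "\<phi> \<in> Cinfc \<Omega>" "open \<Omega>" "bounded \<Omega>"
  shows "\<phi> \<in> Lp p \<Omega>" "grad \<phi> \<in> Lp p \<Omega>"
proof -
  obtain K where K: "compact K" "\<And>x. x \<notin> K \<Longrightarrow> \<phi> x = 0" "\<And>x. x \<notin> K \<Longrightarrow> grad \<phi> x = 0"
    using Cinfc_support[OF assms(1)] by metis
  obtain B where "\<And>x. norm (\<phi> x) \<le> B"
    using bounded_continuous_compact_support[OF Cinfc_continuous[OF assms(1)] K(1,2)] by blast
  then show "\<phi> \<in> Lp p \<Omega>"
    by (intro Lp_continuous_bounded Cinfc_continuous[OF assms(1)] assms(2,3))
  obtain B' where "\<And>x. norm (grad \<phi> x) \<le> B'"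
    using bounded_continuous_compact_support[OF Cinfc_continuous_grad[OF assms(1)] K(1,3)] by blast
  then show "grad \<phi> \<in> Lp p \<Omega>"
    by (intro Lp_continuous_bounded Cinfc_continuous_grad[OF assms(1)] assms(2,3))
qed

text \<open>The weak type estimate asks for classical gradients, so it is applied to differences of
  approximants, via \<open>u = (u - \<phi> k) + (\<phi> k - \<phi> K) + \<phi> K\<close>. The last
  term stays below \<open>t\<close>, so one of the other two reaches \<open>t\<close> wherever
  \<open>u\<close> reaches \<open>3 * t\<close>. A late fixed \<open>K\<close> makes the energy of
  the middle term small enough for any prescribed rate \<open>M\<close>.\<close>

lemma W1_0_exponential_tail:
  fixes u :: "real^'n \<Rightarrow> real"
  defines "n \<equiv> CARD('n)"
  assumes n: "n \<ge> 2" and \<Omega>: "open \<Omega>" "bounded \<Omega>" and u: "u \<in> W1_0 n \<Omega>" and M: "M > 0"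
  shows "\<exists>C T. T > 0 \<and> (\<forall>t\<ge>T. emeasure (lebesgue_on \<Omega>) {x \<in> \<Omega>. 3 * t \<le> \<bar>u x\<bar>}
    \<le> ennreal (C * exp (- M * t powr (real n / (real n - 1)))))"
proof -
  let ?L = "lebesgue_on \<Omega>"
  define w where "w = weak_grad \<Omega> u"
  have uL: "u \<in> Lp n \<Omega>" and wL: "w \<in> Lp n \<Omega>"
    using u by (auto simp: W1_0_def W1_def w_def)
  obtain \<phi> where \<phi>: "\<And>k::nat. \<phi> k \<in> Cinfc \<Omega>"
    and lim: "(\<lambda>k. (\<integral>x. \<bar>\<phi> k x - u x\<bar> ^ n \<partial>?L) + (\<integral>x. norm (grad (\<phi> k) x - w x) ^ n \<partial>?L)) \<longlonglongrightarrow> 0"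
    using u unfolding W1_0_def w_def by auto
  define A where "A k = (\<integral>x. \<bar>\<phi> k x - u x\<bar> ^ n \<partial>?L)" for k
  define B where "B k = (\<integral>x. norm (grad (\<phi> k) x - w x) ^ n \<partial>?L)" for k
  have AB: "A k \<ge> 0" "B k \<ge> 0" for k
    unfolding A_def B_def by (auto intro!: Bochner_Integration.integral_nonneg)
  \<comment> \<open>Membership in \<open>Lp\<close> rules out the default value \<open>0\<close> of
    the Bochner integral, so the convergence in \<open>lim\<close> is genuine; \<open>nnA\<close>
    and \<open>nnB\<close> record it for nonnegative integrals.\<close>
  have dA: "(\<lambda>x. \<phi> k x - u x) \<in> Lp n \<Omega>" for k
    by (intro Lp_diff uL Cinfc_in_Lp \<phi> \<Omega>)
  have dB: "(\<lambda>x. grad (\<phi> k) x - w x) \<in> Lp n \<Omega>" for k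
    by (intro Lp_diff wL Cinfc_in_Lp \<phi> \<Omega>)
  have nnA: "(\<integral>\<^sup>+x. ennreal (\<bar>\<phi> k x - u x\<bar> ^ n) \<partial>?L) = ennreal (A k)" for k
    unfolding A_def using dA[of k] by (intro nn_integral_eq_integral) (auto simp: Lp_def)
  have nnB: "(\<integral>\<^sup>+x. ennreal (norm (grad (\<phi> k) x - w x) ^ n) \<partial>?L) = ennreal (B k)" for k
    unfolding B_def using dB[of k] by (intro nn_integral_eq_integral) (auto simp: Lp_def)
  have meas: "u \<in> borel_measurable ?L" "\<phi> k \<in> borel_measurable ?L" "grad (\<phi> k) \<in> borel_measurable ?L"
    "w \<in> borel_measurable ?L" for k
    using uL wL Cinfc_in_Lp[OF \<phi>[of k] \<Omega>, of n] by (auto simp: Lp_def)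
  note [measurable] = meas
  have \<Omega>_meas: "\<Omega> \<in> lmeasurable" using \<Omega> by (simp add: lmeasurable_open)
  define m where "m = measure ?L \<Omega>"
  interpret fin: finite_measure ?L
    by (rule finite_measure_lebesgue_on[OF \<Omega>_meas])
  have m: "emeasure ?L \<Omega> = ennreal m" "m \<ge> 0"
    unfolding m_def by (simp_all add: fin.emeasure_eq_measure)
  obtain \<rho> where \<rho>: "\<rho> > 0" "\<And>x. x \<in> \<Omega> \<Longrightarrow> norm x < \<rho>"
    using \<Omega>(2) by (metis bounded_pos_less)
  define a where "a = measure lborel (annulus :: (real^'n) set)"
  have a: "a > 0" unfolding a_def by (rule measure_annulus_pos)
  \<comment> \<open>With \<open>\<tau>\<close> proportional to
    \<open>1 / t powr (1 / (real n - 1))\<close>, the energy bound required by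
    \<open>weak_type_exponential_estimate\<close> is this same number at every level
    \<open>t\<close>.\<close>
  define G where "G = a / (4 * (4 * M) ^ (n - 1))"
  have G: "G > 0" using a M by (simp add: G_def)
  \<comment> \<open>Two such bounds, multiplied by the factor \<open>2 ^ n\<close> of
    \<open>power_norm_diff_le\<close>, add up to \<open>G\<close>.\<close>
  have "eventually (\<lambda>k. A k + B k < G / 2 ^ Suc n) sequentially"
    using lim G unfolding A_def B_def by (intro order_tendstoD(2)) auto
  then obtain K where K: "\<And>k. k \<ge> K \<Longrightarrow> A k + B k < G / 2 ^ Suc n"
    by (auto simp: eventually_sequentially)
  obtain b where b: "\<And>x. norm (\<phi> K x) \<le> b"
    by (metis Cinfc_support \<phi> Cinfc_continuous bounded_continuous_compact_support)
  \<comment> \<open>Levels above \<open>b\<close> absorb \<open>\<phi> K\<close>; levels above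
    \<open>1\<close> allow the factor \<open>1 / t\<close> to be dropped and Chebyshev's inequality
    to be used with n-th powers.\<close>
  define T where "T = max 1 b"
  \<comment> \<open>\<open>8 * \<rho>\<close> comes from the weak type estimate, and
    \<open>m + G\<close> bounds the L^1 norm of the gradient through
    \<open>norm y \<le> 1 + norm y ^ n\<close>.\<close>
  define C where "C = 8 * \<rho> * (m + G)"
  have C: "C \<ge> 0" using \<rho> m G by (simp add: C_def)
  have est: "emeasure ?L {x \<in> \<Omega>. 3 * t \<le> \<bar>u x\<bar>}
      \<le> ennreal (A k + C * exp (- M * t powr (real n / (real n - 1))))"
    if t: "t \<ge> T" and k: "k \<ge> K" for t k
  proof -
    have t1: "t \<ge> 1" "t \<ge> b" using t by (auto simp: T_def)
    define \<psi> where "\<psi> x = \<phi> k x - \<phi> K x" for x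
    define g where "g x = grad (\<phi> k) x - grad (\<phi> K) x" for x
    have der: "(\<psi> has_derivative (\<lambda>h. g x \<bullet> h)) (at x)" for x
      unfolding \<psi>_def g_def inner_diff_left
      by (intro has_derivative_diff has_derivative_grad Cinfc_differentiable[OF \<phi>])
    have cont: "continuous_on UNIV g"
      unfolding g_def by (intro continuous_on_diff Cinfc_continuous_grad[OF \<phi>])
    have off: "\<psi> x = 0" "g x = 0" if "x \<notin> \<Omega>" for x
      using that Cinfc_support[OF \<phi>[of k]] Cinfc_support[OF \<phi>[of K]]
      unfolding \<psi>_def g_def by (metis diff_self subsetD)+
    have supp: "\<psi> x = 0" if "\<rho> \<le> norm x" for x
      using that \<rho>(2)[of x] off(1)[of x] by fastforce
    have [measurable]: "g \<in> borel_measurable borel"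
      using cont by (rule borel_measurable_continuous_onI)
    have [measurable]: "\<psi> \<in> borel_measurable borel"
      using der by (intro borel_measurable_continuous_onI)
        (metis continuous_at_imp_continuous_on has_derivative_continuous)
    \<comment> \<open>Since \<open>g\<close> vanishes off \<open>\<Omega>\<close> and
      \<open>f 0 = 0\<close>, the Borel integral over the whole space and the integral for the
      restricted completed measure coincide.\<close>
    have restr: "(\<integral>\<^sup>+x. f (g x) \<partial>lborel) = (\<integral>\<^sup>+x. f (g x) \<partial>?L)"
      if "f 0 = 0" "f \<in> borel_measurable borel" for f :: "real^'n \<Rightarrow> ennreal"
    proof -
      have "(\<integral>\<^sup>+x. f (g x) \<partial>lborel) = (\<integral>\<^sup>+x. f (g x) * indicator \<Omega> x \<partial>lebesgue)"
        unfolding nn_integral_completion using off that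
        by (intro nn_integral_cong) (auto simp: indicator_def)
      also have "\<dots> = (\<integral>\<^sup>+x. f (g x) \<partial>?L)"
        using \<Omega>_meas by (subst nn_integral_restrict_space) auto
      finally show ?thesis .
    qed
    have int_n: "(\<integral>\<^sup>+x. ennreal (norm (g x) ^ n) \<partial>?L) \<le> ennreal G"
    proof -
      have "(\<integral>\<^sup>+x. ennreal (norm (g x) ^ n) \<partial>?L)
        \<le> (\<integral>\<^sup>+x. ennreal (2 ^ n) * (ennreal (norm (grad (\<phi> k) x - w x) ^ n)
              + ennreal (norm (grad (\<phi> K) x - w x) ^ n)) \<partial>?L)"
        unfolding g_def
        by (intro nn_integral_mono, subst ennreal_plus[symmetric])
          (auto simp: ennreal_mult[symmetric] simp del: ennreal_plus intro!: ennreal_leI power_norm_diff_le)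
      also have "\<dots> = ennreal (2 ^ n) * (ennreal (B k) + ennreal (B K))"
        by (simp add: nn_integral_cmult nn_integral_add nnB)
      also have "\<dots> = ennreal (2 ^ n * (B k + B K))"
        using AB by (simp add: ennreal_mult)
      also have "2 ^ n * (B k + B K) \<le> 2 ^ n * (G / 2 ^ Suc n + G / 2 ^ Suc n)"
        using K[OF k] K[OF order_refl] AB[of k] AB[of K] by (intro mult_left_mono add_mono) auto
      also have "\<dots> = G" by (simp add: field_simps)
      finally show ?thesis by (simp add: ennreal_leI)
    qed
    have int_1: "(\<integral>\<^sup>+x. ennreal (norm (g x)) \<partial>?L) \<le> ennreal (m + G)"
    proof -
      have "norm y \<le> 1 + norm y ^ n" for y :: "real^'n"
      proof (cases "norm y \<le> 1")
        case False
        then have "norm y ^ 1 \<le> norm y ^ n" using n by (intro power_increasing) auto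
        then show ?thesis by simp
      qed (simp add: add_increasing2)
      then have "(\<integral>\<^sup>+x. ennreal (norm (g x)) \<partial>?L) \<le> (\<integral>\<^sup>+x. 1 + ennreal (norm (g x) ^ n) \<partial>?L)"
        by (intro nn_integral_mono) (simp add: ennreal_leI flip: ennreal_1 ennreal_plus)
      also have "\<dots> = ennreal m + (\<integral>\<^sup>+x. ennreal (norm (g x) ^ n) \<partial>?L)"
      proof (subst nn_integral_add)
        show "(\<lambda>x. ennreal (norm (g x) ^ n)) \<in> borel_measurable ?L"
          unfolding g_def by measurable
      qed (auto simp: m)
      also have "\<dots> \<le> ennreal m + ennreal G"
        by (intro add_left_mono int_n)
      finally show ?thesis using m G by simp
    qed
    \<comment> \<open>This \<open>\<tau>\<close> makes \<open>t \<tau>\<^bsup>n-1\<^esup>\<close> constant and \<open>t / (4 \<tau>)\<close> equal to the required exponent.\<close>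
    define \<tau> where "\<tau> = 1 / (4 * M * t powr (1 / (real n - 1)))"
    have \<tau>: "\<tau> > 0" using M t1 by (simp add: \<tau>_def)
    have rate: "t / (4 * \<tau>) = M * t powr (real n / (real n - 1))"
    proof -
      have "real n / (real n - 1) = 1 + 1 / (real n - 1)" using n by (simp add: field_simps)
      then have "t powr (real n / (real n - 1)) = t * t powr (1 / (real n - 1))"
        using t1 by (simp add: powr_add)
      then show ?thesis by (simp add: \<tau>_def)
    qed
    have "a * t * \<tau> ^ (n - 1) / 4 = G"
    proof -
      have "(t powr (1 / (real n - 1))) ^ (n - 1) = t"
        using t1 n by (simp add: powr_realpow[symmetric] powr_powr of_nat_diff)
      then have "\<tau> ^ (n - 1) = 1 / ((4 * M) ^ (n - 1) * t)"
        by (simp add: \<tau>_def power_divide power_mult_distrib)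
      then show ?thesis using t1 by (simp add: G_def)
    qed
    then have "(\<integral>\<^sup>+x. ennreal (norm (g x) ^ DIM(real^'n)) \<partial>lborel)
      \<le> ennreal (measure lborel (annulus :: (real^'n) set) * t * \<tau> ^ (DIM(real^'n) - 1) / 4)"
      using int_n restr[of "\<lambda>y. ennreal (norm y ^ n)"] n by (simp add: a_def n_def)
    then have "emeasure lborel {x. t \<le> \<bar>\<psi> x\<bar>}
        \<le> ennreal (8 * \<rho> * exp (- t / (4 * \<tau>)) / t) * (\<integral>\<^sup>+x. ennreal (norm (g x)) \<partial>lborel)"
      using n t1 by (intro weak_type_exponential_estimate der cont supp \<rho> \<tau>) (auto simp: n_def)
    also have "\<dots> \<le> ennreal (8 * \<rho> * exp (- M * t powr (real n / (real n - 1)))) * ennreal (m + G)"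
    proof (rule mult_mono)
      show "(\<integral>\<^sup>+x. ennreal (norm (g x)) \<partial>lborel) \<le> ennreal (m + G)"
        using int_1 restr[of "\<lambda>y. ennreal (norm y)"] by simp
      have "8 * \<rho> * exp (- t / (4 * \<tau>)) / t \<le> 8 * \<rho> * exp (- t / (4 * \<tau>)) / 1"
        using \<rho> t1 by (intro divide_left_mono) auto
      then show "ennreal (8 * \<rho> * exp (- t / (4 * \<tau>)) / t)
        \<le> ennreal (8 * \<rho> * exp (- M * t powr (real n / (real n - 1))))"
        by (intro ennreal_leI) (simp add: rate)
    qed auto
    also have "\<dots> = ennreal (C * exp (- M * t powr (real n / (real n - 1))))"
      using \<rho> m G by (simp add: C_def ennreal_mult[symmetric] mult_ac del: ennreal_plus)
    finally have e\<psi>: "emeasure lborel {x. t \<le> \<bar>\<psi> x\<bar>} \<le> ennreal (C * exp (- M * t powr (real n / (real n - 1))))" .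
    \<comment> \<open>Chebyshev at level 1 instead of \<open>t\<close>: because
      \<open>t \<ge> 1\<close> the n-th power is at least 1, and the crude bound is enough as
      \<open>A k\<close> tends to 0.\<close>
    have eA: "emeasure ?L {x \<in> \<Omega>. t \<le> \<bar>\<phi> k x - u x\<bar>} \<le> ennreal (A k)"
    proof -
      have "emeasure ?L {x \<in> \<Omega>. t \<le> \<bar>\<phi> k x - u x\<bar>}
        \<le> emeasure ?L {x \<in> space ?L. 1 \<le> 1 * ennreal (\<bar>\<phi> k x - u x\<bar> ^ n)}"
      proof (rule emeasure_mono)
        show "{x \<in> \<Omega>. t \<le> \<bar>\<phi> k x - u x\<bar>} \<subseteq> {x \<in> space ?L. 1 \<le> 1 * ennreal (\<bar>\<phi> k x - u x\<bar> ^ n)}"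
          using t1 by (auto intro!: one_le_power simp: space_restrict_space)
      qed measurable
      also have "\<dots> \<le> 1 * (\<integral>\<^sup>+x. ennreal (\<bar>\<phi> k x - u x\<bar> ^ n) * indicator (space ?L) x \<partial>?L)"
        by (rule nn_integral_Markov_inequality) measurable
      also have "\<dots> = (\<integral>\<^sup>+x. ennreal (\<bar>\<phi> k x - u x\<bar> ^ n) \<partial>?L)"
        by (auto intro!: nn_integral_cong)
      finally show ?thesis by (simp add: nnA)
    qed
    have sp: "space ?L = \<Omega>" by (simp add: space_restrict_space)
    have s1: "{x \<in> \<Omega>. t \<le> \<bar>\<phi> k x - u x\<bar>} \<in> sets ?L"
    proof -
      have "{x \<in> space ?L. t \<le> \<bar>\<phi> k x - u x\<bar>} \<in> sets ?L" by measurable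
      then show ?thesis by (simp only: sp)
    qed
    have s2: "{x \<in> \<Omega>. t \<le> \<bar>\<psi> x\<bar>} \<in> sets ?L"
    proof -
      have "{x \<in> space ?L. t \<le> \<bar>\<psi> x\<bar>} \<in> sets ?L" unfolding \<psi>_def by measurable
      then show ?thesis by (simp only: sp)
    qed
    have "emeasure ?L {x \<in> \<Omega>. 3 * t \<le> \<bar>u x\<bar>}
      \<le> emeasure ?L ({x \<in> \<Omega>. t \<le> \<bar>\<phi> k x - u x\<bar>} \<union> {x \<in> \<Omega>. t \<le> \<bar>\<psi> x\<bar>})"
    proof (rule emeasure_mono)
      show "{x \<in> \<Omega>. 3 * t \<le> \<bar>u x\<bar>} \<subseteq> {x \<in> \<Omega>. t \<le> \<bar>\<phi> k x - u x\<bar>} \<union> {x \<in> \<Omega>. t \<le> \<bar>\<psi> x\<bar>}"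
      proof (safe, rule ccontr)
        fix x assume "3 * t \<le> \<bar>u x\<bar>" "\<not> t \<le> \<bar>\<psi> x\<bar>" "\<not> t \<le> \<bar>\<phi> k x - u x\<bar>"
        then show False using b[of x] t1 by (auto simp: \<psi>_def)
      qed
    qed (use s1 s2 in auto)
    also have "\<dots> \<le> emeasure ?L {x \<in> \<Omega>. t \<le> \<bar>\<phi> k x - u x\<bar>} + emeasure ?L {x \<in> \<Omega>. t \<le> \<bar>\<psi> x\<bar>}"
      by (rule emeasure_subadditive[OF s1 s2])
    also have "\<dots> \<le> ennreal (A k) + ennreal (C * exp (- M * t powr (real n / (real n - 1))))"
    proof (rule add_mono[OF eA])
      have "emeasure ?L {x \<in> \<Omega>. t \<le> \<bar>\<psi> x\<bar>} = emeasure lebesgue {x \<in> \<Omega>. t \<le> \<bar>\<psi> x\<bar>}"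
        using \<Omega>_meas by (intro emeasure_restrict_space) auto
      also have "\<dots> \<le> emeasure lebesgue {x. t \<le> \<bar>\<psi> x\<bar>}"
        by (intro emeasure_mono) (auto intro!: sets_completionI_sets)
      also have "\<dots> = emeasure lborel {x. t \<le> \<bar>\<psi> x\<bar>}"
        by simp
      finally show "emeasure ?L {x \<in> \<Omega>. t \<le> \<bar>\<psi> x\<bar>}
        \<le> ennreal (C * exp (- M * t powr (real n / (real n - 1))))"
        using e\<psi> by simp
    qed
    finally show ?thesis using AB C by simp
  qed
  \<comment> \<open>Let \<open>k\<close> tend to infinity with \<open>K\<close> fixed: the left side
    of \<open>est\<close> does not depend on \<open>k\<close>, and on the right only
    \<open>A k\<close> does.\<close>
  have "emeasure ?L {x \<in> \<Omega>. 3 * t \<le> \<bar>u x\<bar>} \<le> ennreal (C * exp (- M * t powr (real n / (real n - 1))))"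
    if t: "t \<ge> T" for t
  proof (rule LIMSEQ_le_const)
    have A_lim: "A \<longlonglongrightarrow> 0"
    proof (rule tendsto_sandwich[where f="\<lambda>_. 0" and h="\<lambda>k. A k + B k"])
      show "(\<lambda>k. A k + B k) \<longlonglongrightarrow> 0" using lim unfolding A_def B_def .
    qed (use AB in auto)
    have "(\<lambda>k. A k + C * exp (- M * t powr (real n / (real n - 1)))) \<longlonglongrightarrow> 0 + C * exp (- M * t powr (real n / (real n - 1)))"
      by (intro tendsto_intros A_lim)
    then show "(\<lambda>k. ennreal (A k + C * exp (- M * t powr (real n / (real n - 1)))))
        \<longlonglongrightarrow> ennreal (C * exp (- M * t powr (real n / (real n - 1))))"
      by (intro tendsto_ennrealI) simp
  qed (use est[OF t] in blast)
  moreover have "T > 0" by (simp add: T_def)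
  ultimately show ?thesis by blast
qed

section \<open>Ranges of the logarithmic weights and of the polar\<close>

text \<open>The denominator is at least \<open>1\<close> because the logarithm is nonpositive. As
  the range is again within \<open>[0, 1]\<close>, the bounds pass to the iterate
  \<open>X2\<close>.\<close>

lemma X1_bounds:
  assumes "0 \<le> t" "t \<le> 1"
  shows "0 \<le> X1 t" "X1 t \<le> 1"
proof -
  have "ln t \<le> 0" if "t \<noteq> 0" using assms that by simp
  then show "0 \<le> X1 t" "X1 t \<le> 1"
    by (auto simp: X1_def intro!: inverse_le_1_iff[THEN iffD2])
qed

lemma X2_bounds:
  assumes "0 \<le> t" "t \<le> 1"
  shows "0 \<le> X2 t" "X2 t \<le> 1"
  using X1_bounds[OF X1_bounds[OF assms]] by (auto simp: X2_def)

text \<open>Cauchy-Schwarz and the lower bound on \<open>F\<close> control every quotient, so the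
  supremum is over a bounded set. By evenness the quotients at \<open>e\<close> and
  \<open>- e\<close> are opposite, and a number above both is nonnegative.\<close>

lemma polar_bounds:
  fixes F :: "real^'n \<Rightarrow> real"
  assumes \<alpha>: "\<alpha> > 0" and F: "\<And>\<xi>. \<alpha> * norm \<xi> \<le> F \<xi>" and even: "\<And>\<xi>. F (- \<xi>) = F \<xi>"
  shows "0 \<le> polar F x" "polar F x \<le> norm x / \<alpha>"
proof -
  have le: "(\<xi> \<bullet> x) / F \<xi> \<le> norm x / \<alpha>" if "\<xi> \<noteq> 0" for \<xi>
  proof -
    have "0 < \<alpha> * norm \<xi>" using that \<alpha> by simp
    then have "0 < F \<xi>" using F[of \<xi>] by linarith
    moreover have "\<xi> \<bullet> x * \<alpha> \<le> norm x * F \<xi>"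
    proof -
      have "\<xi> \<bullet> x * \<alpha> \<le> norm \<xi> * norm x * \<alpha>"
        using \<alpha> norm_cauchy_schwarz[of \<xi> x] by (intro mult_right_mono) auto
      also have "\<dots> = norm x * (\<alpha> * norm \<xi>)" by simp
      also have "\<dots> \<le> norm x * F \<xi>" by (intro mult_left_mono F) auto
      finally show ?thesis .
    qed
    ultimately show ?thesis using \<alpha> by (simp add: divide_le_eq pos_le_divide_eq)
  qed
  then have bdd: "bdd_above ((\<lambda>\<xi>. (\<xi> \<bullet> x) / F \<xi>) ` (- {0}))"
    by (intro bdd_aboveI2[where M="norm x / \<alpha>"]) auto
  obtain e :: "real^'n" where e: "e \<noteq> 0" by (metis axis_eq_0_iff zero_neq_one)
  have "(\<xi> \<bullet> x) / F \<xi> \<le> polar F x" if "\<xi> \<noteq> 0" for \<xi>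
    unfolding polar_def using that by (intro cSUP_upper bdd) auto
  from this[of e] this[of "- e"] e
  have "(e \<bullet> x) / F e \<le> polar F x" "- ((e \<bullet> x) / F e) \<le> polar F x"
    by (simp_all add: even)
  then show "0 \<le> polar F x" by linarith
  show "polar F x \<le> norm x / \<alpha>"
    unfolding polar_def using e le by (intro cSUP_least) auto
qed

section \<open>Removing the weight and integrating the tail\<close>

theorem theorem3p3:
  fixes F :: "real^'n \<Rightarrow> real"
    and \<Omega> :: "(real^'n) set"
    and u :: "real^'n \<Rightarrow> real"
    and \<alpha> \<sigma> \<gamma> :: real
  assumes "CARD('n) \<ge> 2"
    and "strongly_convex_finsler_norm F"
    and "\<alpha> > 0" and "\<forall>\<xi>. \<alpha> * norm \<xi> \<le> F \<xi>"
    and "sigma_constant F \<sigma>"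
    and "bounded_domain \<Omega>" and "0 \<in> \<Omega>"
    and "u \<in> W1_0 CARD('n) \<Omega>" and "\<not> (AE x in lebesgue_on \<Omega>. u x = 0)"
    and "\<gamma> < (C_const F \<alpha> \<sigma> ^ CARD('n) * I_fun F \<Omega> u (weak_grad \<Omega> u))
               powr (- 1 / (real CARD('n) - 1))"
  shows "(\<integral>\<^sup>+ x. ennreal (exp (\<gamma> *
            (\<bar>u x\<bar> * X2 (polar F x / R_of F \<Omega>) powr (2 / real CARD('n)))
              powr (real CARD('n) / (real CARD('n) - 1)))) \<partial>lebesgue_on \<Omega>) < \<infinity>"
proof -
  define q where "q = real CARD('n) / (real CARD('n) - 1)"
  have q: "q > 0" using assms(1) by (simp add: q_def)
  \<comment> \<open>\<open>\<gamma>\<close> may be negative; a nonnegative coefficient makes the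
    exponential increasing in the absolute value of \<open>u\<close>.\<close>
  define c where "c = max \<gamma> 0"
  have c: "c \<ge> 0" "\<gamma> \<le> c" by (auto simp: c_def)
  have \<Omega>: "open \<Omega>" "bounded \<Omega>" using assms(6) by (auto simp: bounded_domain_def)
  then have \<Omega>_meas: "\<Omega> \<in> lmeasurable" by (simp add: lmeasurable_open)
  have [measurable]: "u \<in> borel_measurable (lebesgue_on \<Omega>)"
    using assms(8) by (auto simp: W1_0_def W1_def Lp_def)
  \<comment> \<open>The factor \<open>3 powr q\<close> offsets the level \<open>3 * t\<close> in the
    tail estimate: with \<open>s = (3 * t) powr q\<close> the decay becomes
    \<open>exp (- (c + 1) * s)\<close>, the rate asked for by
    \<open>nn_integral_exp_finite\<close>.\<close>
  have M: "3 powr q * (c + 1) > 0" using c by simp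
  obtain C T where T: "T > 0" and tail: "\<And>t. t \<ge> T \<Longrightarrow>
      emeasure (lebesgue_on \<Omega>) {x \<in> \<Omega>. 3 * t \<le> \<bar>u x\<bar>} \<le> ennreal (C * exp (- (3 powr q * (c + 1)) * t powr q))"
    using W1_0_exponential_tail[OF assms(1) \<Omega> assms(8) M] unfolding q_def by blast
  have pol: "0 \<le> polar F x" "polar F x \<le> norm x / \<alpha>" for x
    using polar_bounds[of \<alpha> F] assms(2-4) by (auto simp: strongly_convex_finsler_norm_def)
  obtain \<rho> where \<rho>: "\<And>x. x \<in> \<Omega> \<Longrightarrow> norm x \<le> \<rho>"
    using \<Omega>(2) by (auto simp: bounded_iff)
  \<comment> \<open>The polar is bounded on \<open>\<Omega>\<close>, so
    \<open>R_of F \<Omega>\<close> is an actual supremum and dominates each value. A zero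
    denominator would make the quotient \<open>0\<close>, which is also in range.\<close>
  have ratio: "0 \<le> polar F x / R_of F \<Omega>" "polar F x / R_of F \<Omega> \<le> 1" if "x \<in> \<Omega>" for x
  proof -
    have "polar F y \<le> \<rho> / \<alpha>" if "y \<in> \<Omega>" for y
      using pol(2)[of y] \<rho>[OF that] assms(3) by (meson divide_right_mono less_imp_le order_trans)
    then have "polar F x \<le> R_of F \<Omega>"
      unfolding R_of_def using that by (intro cSUP_upper bdd_aboveI2) auto
    then show "0 \<le> polar F x / R_of F \<Omega>" "polar F x / R_of F \<Omega> \<le> 1"
      using pol(1)[of x] by (auto simp: divide_le_eq_1)
  qed
  \<comment> \<open>The weight lies in \<open>[0, 1]\<close>, and \<open>\<gamma> \<le> c\<close>
    with \<open>c\<close> nonnegative, so dropping the weight and passing to \<open>c\<close> only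
    enlarges the integrand.\<close>
  have "(\<integral>\<^sup>+ x. ennreal (exp (\<gamma> * (\<bar>u x\<bar> * X2 (polar F x / R_of F \<Omega>) powr (2 / real CARD('n))) powr q))
      \<partial>lebesgue_on \<Omega>) \<le> (\<integral>\<^sup>+ x. ennreal (exp (c * (\<bar>u x\<bar> powr q))) \<partial>lebesgue_on \<Omega>)"
  proof (rule nn_integral_mono)
    fix x assume "x \<in> space (lebesgue_on \<Omega>)"
    then have "x \<in> \<Omega>" by (simp add: space_restrict_space)
    note X = X2_bounds[OF ratio[OF this]]
    let ?w = "X2 (polar F x / R_of F \<Omega>) powr (2 / real CARD('n))"
    have "?w \<le> 1" using X by (intro powr_le1) auto
    then have "\<bar>u x\<bar> * ?w \<le> \<bar>u x\<bar>" by (simp add: mult_left_le)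
    then have "(\<bar>u x\<bar> * ?w) powr q \<le> \<bar>u x\<bar> powr q"
      using q by (intro powr_mono2) auto
    then have "\<gamma> * (\<bar>u x\<bar> * ?w) powr q \<le> c * \<bar>u x\<bar> powr q"
      using c by (intro mult_mono) auto
    then show "ennreal (exp (\<gamma> * (\<bar>u x\<bar> * ?w) powr q)) \<le> ennreal (exp (c * \<bar>u x\<bar> powr q))"
      by (intro ennreal_leI) simp
  qed
  also have "\<dots> < \<infinity>"
  proof (rule nn_integral_exp_finite)
    show "emeasure (lebesgue_on \<Omega>) (space (lebesgue_on \<Omega>)) < \<infinity>"
      using \<Omega>_meas finite_measure.finite_emeasure_space[OF finite_measure_lebesgue_on]
      by (simp add: top.not_eq_extremum)
    fix s assume s: "s \<ge> (3 * T) powr q"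
    have "0 < (3 * T) powr q" using T by simp
    with s have s0: "s > 0" by linarith
    \<comment> \<open>Solves \<open>s = (3 * t) powr q\<close>; the threshold imposed on
      \<open>s\<close> is then exactly \<open>t \<ge> T\<close>.\<close>
    define t where "t = s powr (1 / q) / 3"
    have sq: "s powr (1 / q) \<ge> 3 * T"
    proof -
      have "3 * T = ((3 * T) powr q) powr (1 / q)" using T q by (simp add: powr_powr)
      also have "\<dots> \<le> s powr (1 / q)" using s q by (intro powr_mono2) auto
      finally show ?thesis .
    qed
    have tq: "3 powr q * t powr q = s"
      using s0 q by (simp add: t_def powr_mult[symmetric] powr_powr)
    have "{x \<in> space (lebesgue_on \<Omega>). s \<le> \<bar>u x\<bar> powr q} \<subseteq> {x \<in> \<Omega>. 3 * t \<le> \<bar>u x\<bar>}"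
    proof safe
      fix x assume "s \<le> \<bar>u x\<bar> powr q"
      then have "s powr (1 / q) \<le> (\<bar>u x\<bar> powr q) powr (1 / q)"
        using s0 q by (intro powr_mono2) auto
      also have "\<dots> = \<bar>u x\<bar>" using q by (simp add: powr_powr)
      finally show "3 * t \<le> \<bar>u x\<bar>" by (simp add: t_def)
    qed (simp add: space_restrict_space)
    moreover have "{x \<in> \<Omega>. 3 * t \<le> \<bar>u x\<bar>} \<in> sets (lebesgue_on \<Omega>)"
    proof -
      have "{x \<in> space (lebesgue_on \<Omega>). 3 * t \<le> \<bar>u x\<bar>} \<in> sets (lebesgue_on \<Omega>)" by measurable
      then show ?thesis by (simp add: space_restrict_space)
    qed
    ultimately have "emeasure (lebesgue_on \<Omega>) {x \<in> space (lebesgue_on \<Omega>). s \<le> \<bar>u x\<bar> powr q}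
      \<le> emeasure (lebesgue_on \<Omega>) {x \<in> \<Omega>. 3 * t \<le> \<bar>u x\<bar>}"
      by (rule emeasure_mono)
    also have "\<dots> \<le> ennreal (C * exp (- (3 powr q * (c + 1)) * t powr q))"
      using sq by (intro tail) (simp add: t_def)
    also have "- (3 powr q * (c + 1)) * t powr q = - (c + 1) * s"
      using tq by (simp add: algebra_simps)
    finally show "emeasure (lebesgue_on \<Omega>) {x \<in> space (lebesgue_on \<Omega>). s \<le> \<bar>u x\<bar> powr q}
      \<le> ennreal (C * exp (- (c + 1) * s))" .
  qed (use c in auto)
  finally show ?thesis by (simp add: q_def)
qed

end
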